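(* Let $\mathcal{C}$ be a standard closure system over a finite set $U$ with acyclic split $(U_1,U_2)$. Let $\mathcal{C}_1=\{C\cap U_1 : C\in\mathcal{C},\ U_2\subseteq C\}$ (a closure system over $U_1$) and $\mathcal{C}_2=\{C\in\mathcal{C}: C\subseteq U_2\}$ (a closure system over $U_2$), and let $\mathcal{M}$, $\mathcal{M}_1$, $\mathcal{M}_2$ be the sets of meet-irreducible elements of $\mathcal{C}$, $\mathcal{C}_1$, $\mathcal{C}_2$ respectively. Then $|\mathcal{M}|\ge|\mathcal{M}_1|+|\mathcal{M}_2|$ and \[\mathcal{M}=\{M_1\cup U_2 : M_1\in\mathcal{M}_1\}\ \cup\ \{C\in\max(\mathrm{Ext}(M_2)) : M_2\in\mathcal{M}_2\},\] where $\max(\mathrm{Ext}(M_2))$ denotes the inclusion-maximal elements of $\mathrm{Ext}(M_2)=\{C\in\mathcal{C}: C\cap U_2=M_2\}$.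
   Context: A closure system over $U$ is a family $\mathcal{C}$ of subsets of $U$ with $U\in\mathcal{C}$ and closed under intersection; with closure operator $\phi(X)=\bigcap\{C\in\mathcal{C}: X\subseteq C\}$ it is standard if $\phi(\{u\})\setminus\{u\}\in\mathcal{C}$ for every $u\in U$. A meet-irreducible element of a closure system $\mathcal{F}$ over a set $V$ is a closed set $M\neq V$ such that $M=C\cap C'$ with $C,C'\in\mathcal{F}$ implies $M=C$ or $M=C'$ (equivalently, $M$ has exactly one upper cover in $\mathcal{F}$). An implication over $U$ is written $A \to b$ with $A \subseteq U$ nonempty and $b \in U$; an implicational base is a finite set of implications; $\Sigma$ is an implicational base for $\mathcal{C}$ if $\mathcal{C}$ is exactly the family of $C\subseteq U$ such that $A\subseteq C$ implies $b\in C$ for all $A\to b\in\Sigma$. For $X\subseteq U$, $\Sigma[X]=\{A\to b\in\Sigma: A\cup\{b\}\subseteq X\}$, and $\Sigma[U_1,U_2]:=\Sigma\setminus(\Sigma[U_1]\cup\Sigma[U_2])$. A bipartition $(U_1,U_2)$ of $U$ into nonempty disjoint parts with $U_2\in\mathcal{C}$ is an acyclic split of $\mathcal{C}$ if there is an implicational base $\Sigma$ for $\mathcal{C}$ in which every premise is contained in $U_1$ or in $U_2$ and every $A\to b\in\Sigma[U_1,U_2]$ has $A\subseteq U_1$. *)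

theory Defs
  imports Complex_Main
begin

definition closure_system :: "'a set \<Rightarrow> 'a set set \<Rightarrow> bool" where
  "closure_system U \<C> \<longleftrightarrow> \<C> \<subseteq> Pow U \<and> U \<in> \<C> \<and> (\<forall>\<D>\<subseteq>\<C>. \<D> \<noteq> {} \<longrightarrow> \<Inter>\<D> \<in> \<C>)"

definition closure_operator :: "'a set set \<Rightarrow> 'a set \<Rightarrow> 'a set" where
  "closure_operator \<C> X = \<Inter>{C \<in> \<C>. X \<subseteq> C}"

definition standard_closure_system :: "'a set \<Rightarrow> 'a set set \<Rightarrow> bool" where
  "standard_closure_system U \<C> \<longleftrightarrow>
     closure_system U \<C> \<and> (\<forall>u\<in>U. closure_operator \<C> {u} - {u} \<in> \<C>)"

definition meet_irreducibles :: "'a set \<Rightarrow> 'a set set \<Rightarrow> 'a set set" where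
  "meet_irreducibles V \<F> =
     {M \<in> \<F>. M \<noteq> V \<and> (\<forall>C\<in>\<F>. \<forall>C'\<in>\<F>. M = C \<inter> C' \<longrightarrow> M = C \<or> M = C')}"

text \<open>The pair (A, b) encodes the implication with premise A and conclusion b.\<close>

type_synonym 'a implication = "'a set \<times> 'a"

definition implicational_base :: "'a set \<Rightarrow> 'a implication set \<Rightarrow> bool" where
  "implicational_base U \<Sigma> \<longleftrightarrow>
     finite \<Sigma> \<and> (\<forall>(A, b)\<in>\<Sigma>. A \<noteq> {} \<and> A \<subseteq> U \<and> b \<in> U)"

definition implicational_base_for :: "'a set \<Rightarrow> 'a set set \<Rightarrow> 'a implication set \<Rightarrow> bool" where
  "implicational_base_for U \<C> \<Sigma> \<longleftrightarrow>
     implicational_base U \<Sigma> \<and> \<C> = {C. C \<subseteq> U \<and> (\<forall>(A, b)\<in>\<Sigma>. A \<subseteq> C \<longrightarrow> b \<in> C)}"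

definition induced_base :: "'a implication set \<Rightarrow> 'a set \<Rightarrow> 'a implication set" where
  "induced_base \<Sigma> X = {(A, b) \<in> \<Sigma>. A \<union> {b} \<subseteq> X}"

definition crossing_base :: "'a implication set \<Rightarrow> 'a set \<Rightarrow> 'a set \<Rightarrow> 'a implication set" where
  "crossing_base \<Sigma> U\<^sub>1 U\<^sub>2 = \<Sigma> - (induced_base \<Sigma> U\<^sub>1 \<union> induced_base \<Sigma> U\<^sub>2)"

definition bipartition :: "'a set \<Rightarrow> 'a set \<Rightarrow> 'a set \<Rightarrow> bool" where
  "bipartition U U\<^sub>1 U\<^sub>2 \<longleftrightarrow> U\<^sub>1 \<noteq> {} \<and> U\<^sub>2 \<noteq> {} \<and> U\<^sub>1 \<inter> U\<^sub>2 = {} \<and> U\<^sub>1 \<union> U\<^sub>2 = U"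

definition acyclic_split :: "'a set \<Rightarrow> 'a set set \<Rightarrow> 'a set \<Rightarrow> 'a set \<Rightarrow> bool" where
  "acyclic_split U \<C> U\<^sub>1 U\<^sub>2 \<longleftrightarrow>
     bipartition U U\<^sub>1 U\<^sub>2 \<and> U\<^sub>2 \<in> \<C> \<and>
     (\<exists>\<Sigma>. implicational_base_for U \<C> \<Sigma> \<and>
        (\<forall>(A, b)\<in>\<Sigma>. A \<subseteq> U\<^sub>1 \<or> A \<subseteq> U\<^sub>2) \<and>
        (\<forall>(A, b)\<in>crossing_base \<Sigma> U\<^sub>1 U\<^sub>2. A \<subseteq> U\<^sub>1))"

definition contraction :: "'a set set \<Rightarrow> 'a set \<Rightarrow> 'a set \<Rightarrow> 'a set set" where
  "contraction \<C> U\<^sub>1 U\<^sub>2 = {C \<inter> U\<^sub>1 | C. C \<in> \<C> \<and> U\<^sub>2 \<subseteq> C}"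

definition restriction :: "'a set set \<Rightarrow> 'a set \<Rightarrow> 'a set set" where
  "restriction \<C> U\<^sub>2 = {C \<in> \<C>. C \<subseteq> U\<^sub>2}"

definition Ext :: "'a set set \<Rightarrow> 'a set \<Rightarrow> 'a set \<Rightarrow> 'a set set" where
  "Ext \<C> U\<^sub>2 M\<^sub>2 = {C \<in> \<C>. C \<inter> U\<^sub>2 = M\<^sub>2}"

definition max_sets :: "'a set set \<Rightarrow> 'a set set" where
  "max_sets \<F> = {X \<in> \<F>. \<forall>Y\<in>\<F>. X \<subseteq> Y \<longrightarrow> X = Y}"

lemma closure_system_contraction:
  assumes "closure_system U \<C>" and "U\<^sub>1 \<subseteq> U" and "U\<^sub>2 \<subseteq> U"
  shows "closure_system U\<^sub>1 (contraction \<C> U\<^sub>1 U\<^sub>2)"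
  unfolding closure_system_def
proof (intro conjI allI impI)
  show "contraction \<C> U\<^sub>1 U\<^sub>2 \<subseteq> Pow U\<^sub>1"
    by (auto simp: contraction_def)
  show "U\<^sub>1 \<in> contraction \<C> U\<^sub>1 U\<^sub>2"
  proof -
    have "U \<in> \<C>" using assms(1) by (simp add: closure_system_def)
    moreover have "U\<^sub>1 = U \<inter> U\<^sub>1" using assms(2) by blast
    ultimately show ?thesis
      unfolding contraction_def using assms(3) by blast
  qed
next
  fix \<D> assume D: "\<D> \<subseteq> contraction \<C> U\<^sub>1 U\<^sub>2" "\<D> \<noteq> {}"
  define \<E> where "\<E> = {C \<in> \<C>. U\<^sub>2 \<subseteq> C \<and> C \<inter> U\<^sub>1 \<in> \<D>}"
  have D_eq: "\<D> = (\<lambda>C. C \<inter> U\<^sub>1) ` \<E>"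
  proof
    show "\<D> \<subseteq> (\<lambda>C. C \<inter> U\<^sub>1) ` \<E>"
    proof
      fix X assume X: "X \<in> \<D>"
      with D(1) have "X \<in> contraction \<C> U\<^sub>1 U\<^sub>2" ..
      then obtain C where "C \<in> \<C>" "U\<^sub>2 \<subseteq> C" "X = C \<inter> U\<^sub>1"
        unfolding contraction_def by blast
      with X show "X \<in> (\<lambda>C. C \<inter> U\<^sub>1) ` \<E>" unfolding \<E>_def by simp
    qed
    show "(\<lambda>C. C \<inter> U\<^sub>1) ` \<E> \<subseteq> \<D>" unfolding \<E>_def by blast
  qed
  from D(2) have "\<E> \<noteq> {}" unfolding D_eq by simp
  moreover have "\<E> \<subseteq> \<C>" by (auto simp: \<E>_def)
  ultimately have closed: "\<Inter>\<E> \<in> \<C>"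
    using assms(1) by (simp add: closure_system_def)
  have sub: "U\<^sub>2 \<subseteq> \<Inter>\<E>" by (auto simp: \<E>_def)
  have "\<Inter>\<D> = \<Inter>\<E> \<inter> U\<^sub>1" unfolding D_eq using \<open>\<E> \<noteq> {}\<close> by blast
  with closed sub show "\<Inter>\<D> \<in> contraction \<C> U\<^sub>1 U\<^sub>2"
    unfolding contraction_def by blast
qed

lemma closure_system_restriction:
  assumes "closure_system U \<C>" and "U\<^sub>2 \<in> \<C>"
  shows "closure_system U\<^sub>2 (restriction \<C> U\<^sub>2)"
  unfolding closure_system_def
proof (intro conjI allI impI)
  show "restriction \<C> U\<^sub>2 \<subseteq> Pow U\<^sub>2" and "U\<^sub>2 \<in> restriction \<C> U\<^sub>2"
    using assms(2) by (auto simp: restriction_def)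
next
  fix \<D> assume D: "\<D> \<subseteq> restriction \<C> U\<^sub>2" "\<D> \<noteq> {}"
  then have "\<D> \<subseteq> \<C>" by (auto simp: restriction_def)
  with D(2) assms(1) have "\<Inter>\<D> \<in> \<C>" by (simp add: closure_system_def)
  moreover have "\<Inter>\<D> \<subseteq> U\<^sub>2" using D by (auto simp: restriction_def)
  ultimately show "\<Inter>\<D> \<in> restriction \<C> U\<^sub>2" by (simp add: restriction_def)
qed

end

theory Submission
  imports Defs
begin

text \<open>
  The crossing implications go from $U_1$ to $U_2$, so the trace $C \cap U_2$ of a closed set may be
  replaced by any larger closed subset of $U_2$ without leaving $\mathcal{C}$. Consequently a
  meet-irreducible $M \not\supseteq U_2$ has an irreducible trace $M_2$, and it is maximal in
  $\mathrm{Ext}(M_2)$: for a proper extension $C$ of the same trace, $M = C \cap (M \cup U_2)$ would be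
  a nontrivial decomposition. The irreducibles above $U_2$ are those of an upper interval, which is
  isomorphic to $\mathcal{C}_1$. The converse inclusions are direct, and choosing one maximal
  extension of each $M_2$ gives the bound on cardinalities.
\<close>

lemma closure_system_Int:
  assumes "closure_system U \<C>" "C \<in> \<C>" "D \<in> \<C>"
  shows "C \<inter> D \<in> \<C>"
proof -
  have "{C, D} \<subseteq> \<C>" "{C, D} \<noteq> {}" using assms(2,3) by simp_all
  then have "\<Inter>{C, D} \<in> \<C>"
    using assms(1) unfolding closure_system_def by metis
  then show ?thesis by simp
qed

text \<open>Every premise lies on one side. A premise in \<open>U\<^sub>1\<close> that is contained
  in \<open>C \<union> F\<close> avoids \<open>F\<close>, so it is contained in \<open>C\<close>; a
  premise in \<open>U\<^sub>2\<close> meets \<open>C\<close> only inside the trace, so it is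
  contained in \<open>F\<close>. In both cases a closed set already supplies the conclusion.\<close>

lemma acyclic_split_replace_trace:
  assumes split: "acyclic_split U \<C> U\<^sub>1 U\<^sub>2"
    and C: "C \<in> \<C>" and F: "F \<in> \<C>" "F \<subseteq> U\<^sub>2" "C \<inter> U\<^sub>2 \<subseteq> F"
  shows "C \<union> F \<in> \<C>"
proof -
  obtain \<Sigma> where base: "implicational_base_for U \<C> \<Sigma>"
    and prems: "\<forall>(A, b)\<in>\<Sigma>. A \<subseteq> U\<^sub>1 \<or> A \<subseteq> U\<^sub>2"
    using split unfolding acyclic_split_def by metis
  have disj: "U\<^sub>1 \<inter> U\<^sub>2 = {}"
    using split by (simp add: acyclic_split_def bipartition_def)
  have closed_iff: "X \<in> \<C> \<longleftrightarrow> X \<subseteq> U \<and> (\<forall>(A, b)\<in>\<Sigma>. A \<subseteq> X \<longrightarrow> b \<in> X)" for X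
    using base by (simp add: implicational_base_for_def)
  have closedD: "b \<in> X" if "X \<in> \<C>" "(A, b) \<in> \<Sigma>" "A \<subseteq> X" for X A b
    using that closed_iff[of X] by fastforce
  have "b \<in> C \<union> F" if imp: "(A, b) \<in> \<Sigma>" and A: "A \<subseteq> C \<union> F" for A b
  proof (cases "A \<subseteq> U\<^sub>1")
    case True
    then have "A \<subseteq> C" using A F(2) disj by blast
    then show ?thesis using closedD[OF C imp] by simp
  next
    case False
    then have "A \<subseteq> U\<^sub>2" using imp prems by fastforce
    then have "A \<subseteq> F" using A F(3) by blast
    then show ?thesis using closedD[OF F(1) imp] by simp
  qed
  moreover have "C \<union> F \<subseteq> U" using C F(1) closed_iff by simp
  ultimately show ?thesis unfolding closed_iff[of "C \<union> F"] by auto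
qed

lemma meet_irreduciblesI:
  assumes "M \<in> \<F>" "M \<noteq> V"
    and "\<And>C C'. C \<in> \<F> \<Longrightarrow> C' \<in> \<F> \<Longrightarrow> M = C \<inter> C' \<Longrightarrow> M = C \<or> M = C'"
  shows "M \<in> meet_irreducibles V \<F>"
  using assms unfolding meet_irreducibles_def by blast

lemma meet_irreduciblesD:
  assumes "M \<in> meet_irreducibles V \<F>"
  shows "M \<in> \<F>" "M \<noteq> V"
    and "C \<in> \<F> \<Longrightarrow> C' \<in> \<F> \<Longrightarrow> M = C \<inter> C' \<Longrightarrow> M = C \<or> M = C'"
  using assms unfolding meet_irreducibles_def by blast+

text \<open>On closed sets above \<open>U\<^sub>2\<close>, adding \<open>U\<^sub>2\<close> undoes
  the trace on \<open>U\<^sub>1\<close>. The contraction is thereby described without an existential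
  witness.\<close>

lemma contraction_iff:
  assumes "closure_system U \<C>" "bipartition U U\<^sub>1 U\<^sub>2"
  shows "X \<in> contraction \<C> U\<^sub>1 U\<^sub>2 \<longleftrightarrow> X \<subseteq> U\<^sub>1 \<and> X \<union> U\<^sub>2 \<in> \<C>"
proof
  assume "X \<in> contraction \<C> U\<^sub>1 U\<^sub>2"
  then obtain C where C: "C \<in> \<C>" "U\<^sub>2 \<subseteq> C" "X = C \<inter> U\<^sub>1"
    unfolding contraction_def by blast
  have "C \<subseteq> U" using assms(1) C(1) by (auto simp: closure_system_def)
  then have "X \<union> U\<^sub>2 = C" using C assms(2) by (auto simp: bipartition_def)
  then show "X \<subseteq> U\<^sub>1 \<and> X \<union> U\<^sub>2 \<in> \<C>" using C by simp
next
  assume X: "X \<subseteq> U\<^sub>1 \<and> X \<union> U\<^sub>2 \<in> \<C>"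
  moreover have "X = (X \<union> U\<^sub>2) \<inter> U\<^sub>1" using X assms(2) by (auto simp: bipartition_def)
  ultimately show "X \<in> contraction \<C> U\<^sub>1 U\<^sub>2"
    unfolding contraction_def by blast
qed

text \<open>Adding \<open>U\<^sub>2\<close> is a bijection from the contraction onto the closed sets
  above \<open>U\<^sub>2\<close>, and it preserves intersections. Any two closed sets that meet in
  \<open>X \<union> U\<^sub>2\<close> are themselves above \<open>U\<^sub>2\<close>, so all
  decompositions live in this interval.\<close>

lemma meet_irreducibles_contraction_iff:
  assumes cs: "closure_system U \<C>" and part: "bipartition U U\<^sub>1 U\<^sub>2" and X: "X \<subseteq> U\<^sub>1"
  shows "X \<in> meet_irreducibles U\<^sub>1 (contraction \<C> U\<^sub>1 U\<^sub>2) \<longleftrightarrow> X \<union> U\<^sub>2 \<in> meet_irreducibles U \<C>"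
proof
  note iff = contraction_iff[OF cs part]
  have disj: "U\<^sub>1 \<inter> U\<^sub>2 = {}" and cover: "U\<^sub>1 \<union> U\<^sub>2 = U"
    using part by (auto simp: bipartition_def)
  {
    assume irr: "X \<in> meet_irreducibles U\<^sub>1 (contraction \<C> U\<^sub>1 U\<^sub>2)"
    show "X \<union> U\<^sub>2 \<in> meet_irreducibles U \<C>"
    proof (rule meet_irreduciblesI)
      show "X \<union> U\<^sub>2 \<in> \<C>" using meet_irreduciblesD(1)[OF irr] iff by blast
      show "X \<union> U\<^sub>2 \<noteq> U" using meet_irreduciblesD(2)[OF irr] X disj cover by blast
    next
      fix C C' assume C: "C \<in> \<C>" "C' \<in> \<C>" and eq: "X \<union> U\<^sub>2 = C \<inter> C'"
      have sub: "C \<subseteq> U" "C' \<subseteq> U" using cs C by (auto simp: closure_system_def)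
      have "C \<inter> U\<^sub>1 \<in> contraction \<C> U\<^sub>1 U\<^sub>2" "C' \<inter> U\<^sub>1 \<in> contraction \<C> U\<^sub>1 U\<^sub>2"
        using C eq unfolding contraction_def by blast+
      moreover have "X = (C \<inter> U\<^sub>1) \<inter> (C' \<inter> U\<^sub>1)" using eq X disj by blast
      ultimately have "X = C \<inter> U\<^sub>1 \<or> X = C' \<inter> U\<^sub>1" using meet_irreduciblesD(3)[OF irr] by blast
      \<comment> \<open>Each factor contains \<open>U\<^sub>2\<close> and is thus determined by its
        trace on \<open>U\<^sub>1\<close>.\<close>
      then show "X \<union> U\<^sub>2 = C \<or> X \<union> U\<^sub>2 = C'" using sub eq cover by blast
    qed
  next
    assume irr: "X \<union> U\<^sub>2 \<in> meet_irreducibles U \<C>"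
    show "X \<in> meet_irreducibles U\<^sub>1 (contraction \<C> U\<^sub>1 U\<^sub>2)"
    proof (rule meet_irreduciblesI)
      show "X \<in> contraction \<C> U\<^sub>1 U\<^sub>2" using meet_irreduciblesD(1)[OF irr] X iff by blast
      show "X \<noteq> U\<^sub>1" using meet_irreduciblesD(2)[OF irr] cover by blast
    next
      fix C C' assume C: "C \<in> contraction \<C> U\<^sub>1 U\<^sub>2" "C' \<in> contraction \<C> U\<^sub>1 U\<^sub>2"
        and eq: "X = C \<inter> C'"
      have "C \<union> U\<^sub>2 \<in> \<C>" "C' \<union> U\<^sub>2 \<in> \<C>" and sub: "C \<subseteq> U\<^sub>1" "C' \<subseteq> U\<^sub>1"
        using C iff by auto
      moreover have "X \<union> U\<^sub>2 = (C \<union> U\<^sub>2) \<inter> (C' \<union> U\<^sub>2)" using eq by blast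
      ultimately have "X \<union> U\<^sub>2 = C \<union> U\<^sub>2 \<or> X \<union> U\<^sub>2 = C' \<union> U\<^sub>2"
        using meet_irreduciblesD(3)[OF irr] by blast
      then show "X = C \<or> X = C'" using X sub disj by blast
    qed
  }
qed

lemma meet_irreducible_trace:
  assumes cs: "closure_system U \<C>" and split: "acyclic_split U \<C> U\<^sub>1 U\<^sub>2"
    and irr: "M \<in> meet_irreducibles U \<C>" and not_above: "\<not> U\<^sub>2 \<subseteq> M"
  shows "M \<inter> U\<^sub>2 \<in> meet_irreducibles U\<^sub>2 (restriction \<C> U\<^sub>2)"
    and "M \<in> max_sets (Ext \<C> U\<^sub>2 (M \<inter> U\<^sub>2))"
proof -
  have U2: "U\<^sub>2 \<in> \<C>" using split by (simp add: acyclic_split_def)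
  have M: "M \<in> \<C>" by (rule meet_irreduciblesD(1)[OF irr])
  have replace: "M \<union> F \<in> \<C>" if "F \<in> \<C>" "F \<subseteq> U\<^sub>2" "M \<inter> U\<^sub>2 \<subseteq> F" for F
    using acyclic_split_replace_trace[OF split M that] .
  show "M \<inter> U\<^sub>2 \<in> meet_irreducibles U\<^sub>2 (restriction \<C> U\<^sub>2)"
  proof (rule meet_irreduciblesI)
    show "M \<inter> U\<^sub>2 \<in> restriction \<C> U\<^sub>2"
      using closure_system_Int[OF cs M U2] by (simp add: restriction_def)
    show "M \<inter> U\<^sub>2 \<noteq> U\<^sub>2" using not_above by blast
  next
    fix C C' assume C: "C \<in> restriction \<C> U\<^sub>2" "C' \<in> restriction \<C> U\<^sub>2"
      and eq: "M \<inter> U\<^sub>2 = C \<inter> C'"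
    have C_closed: "C \<in> \<C>" "C' \<in> \<C>" and sub: "C \<subseteq> U\<^sub>2" "C' \<subseteq> U\<^sub>2"
      using C by (simp_all add: restriction_def)
    have "M \<inter> U\<^sub>2 \<subseteq> C" "M \<inter> U\<^sub>2 \<subseteq> C'" using eq by simp_all
    then have "M \<union> C \<in> \<C>" "M \<union> C' \<in> \<C>" using replace C_closed sub by simp_all
    \<comment> \<open>By distributivity the right-hand side is
      \<open>M \<union> (C \<inter> C')\<close>, and \<open>C \<inter> C'\<close> is a trace of
      \<open>M\<close>: a decomposition of the trace lifts to one of \<open>M\<close>.\<close>
    moreover have "M = (M \<union> C) \<inter> (M \<union> C')" using eq by blast
    ultimately have "M = M \<union> C \<or> M = M \<union> C'" using meet_irreduciblesD(3)[OF irr] by blast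
    then have "C \<subseteq> M \<inter> U\<^sub>2 \<or> C' \<subseteq> M \<inter> U\<^sub>2" using sub by (metis Un_upper2 le_inf_iff)
    then show "M \<inter> U\<^sub>2 = C \<or> M \<inter> U\<^sub>2 = C'"
      using \<open>M \<inter> U\<^sub>2 \<subseteq> C\<close> \<open>M \<inter> U\<^sub>2 \<subseteq> C'\<close> by (metis subset_antisym)
  qed
  show "M \<in> max_sets (Ext \<C> U\<^sub>2 (M \<inter> U\<^sub>2))"
  proof -
    have "M = D" if D: "D \<in> \<C>" "D \<inter> U\<^sub>2 = M \<inter> U\<^sub>2" "M \<subseteq> D" for D
    proof -
      have "M \<union> U\<^sub>2 \<in> \<C>" using replace U2 by blast
      moreover have "M = D \<inter> (M \<union> U\<^sub>2)" using D by blast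
      ultimately have "M = D \<or> M = M \<union> U\<^sub>2" using meet_irreduciblesD(3)[OF irr] D(1) by blast
      \<comment> \<open>The alternative \<open>M = M \<union> U\<^sub>2\<close> would put
        \<open>M\<close> above \<open>U\<^sub>2\<close>.\<close>
      then show ?thesis using not_above by blast
    qed
    then show ?thesis using M by (simp add: max_sets_def Ext_def)
  qed
qed

text \<open>Tracing a decomposition of \<open>M\<close> on \<open>U\<^sub>2\<close> decomposes the
  irreducible \<open>N\<close>, so one of the two factors has trace \<open>N\<close>. This factor
  contains \<open>M\<close>, and maximality makes them equal.\<close>

lemma max_Ext_meet_irreducible:
  assumes cs: "closure_system U \<C>" and U2: "U\<^sub>2 \<in> \<C>"
    and irr: "N \<in> meet_irreducibles U\<^sub>2 (restriction \<C> U\<^sub>2)" and max: "M \<in> max_sets (Ext \<C> U\<^sub>2 N)"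
  shows "M \<in> meet_irreducibles U \<C>" and "\<not> U\<^sub>2 \<subseteq> M"
proof -
  have M: "M \<in> \<C>" "M \<inter> U\<^sub>2 = N"
    and maximal: "\<And>D. D \<in> \<C> \<Longrightarrow> D \<inter> U\<^sub>2 = N \<Longrightarrow> M \<subseteq> D \<Longrightarrow> M = D"
    using max by (auto simp: max_sets_def Ext_def)
  show not_above: "\<not> U\<^sub>2 \<subseteq> M" using meet_irreduciblesD(2)[OF irr] M(2) by blast
  show "M \<in> meet_irreducibles U \<C>"
  proof (rule meet_irreduciblesI)
    show "M \<in> \<C>" by fact
    show "M \<noteq> U" using cs U2 not_above by (auto simp: closure_system_def)
  next
    fix C C' assume C: "C \<in> \<C>" "C' \<in> \<C>" and eq: "M = C \<inter> C'"
    have "C \<inter> U\<^sub>2 \<in> restriction \<C> U\<^sub>2" "C' \<inter> U\<^sub>2 \<in> restriction \<C> U\<^sub>2"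
      using closure_system_Int[OF cs _ U2] C by (auto simp: restriction_def)
    moreover have "N = (C \<inter> U\<^sub>2) \<inter> (C' \<inter> U\<^sub>2)" using eq M(2) by blast
    ultimately have "N = C \<inter> U\<^sub>2 \<or> N = C' \<inter> U\<^sub>2" using meet_irreduciblesD(3)[OF irr] by blast
    then show "M = C \<or> M = C'" using maximal C eq by blast
  qed
qed

lemma max_sets_nonempty:
  assumes "finite \<F>" "\<F> \<noteq> {}"
  shows "max_sets \<F> \<noteq> {}"
  using finite_has_maximal[OF assms] unfolding max_sets_def by blast

theorem theorem5:
  fixes U U\<^sub>1 U\<^sub>2 :: "'a set" and \<C> :: "'a set set"
  assumes "finite U"
    and "standard_closure_system U \<C>"
    and "acyclic_split U \<C> U\<^sub>1 U\<^sub>2"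
  shows "card (meet_irreducibles U \<C>) \<ge>
           card (meet_irreducibles U\<^sub>1 (contraction \<C> U\<^sub>1 U\<^sub>2)) +
           card (meet_irreducibles U\<^sub>2 (restriction \<C> U\<^sub>2)) \<and>
         meet_irreducibles U \<C> =
           {M\<^sub>1 \<union> U\<^sub>2 | M\<^sub>1. M\<^sub>1 \<in> meet_irreducibles U\<^sub>1 (contraction \<C> U\<^sub>1 U\<^sub>2)} \<union>
           {C | C M\<^sub>2. M\<^sub>2 \<in> meet_irreducibles U\<^sub>2 (restriction \<C> U\<^sub>2) \<and>
                   C \<in> max_sets (Ext \<C> U\<^sub>2 M\<^sub>2)}"
proof -
  let ?M = "meet_irreducibles U \<C>"
  let ?M1 = "meet_irreducibles U\<^sub>1 (contraction \<C> U\<^sub>1 U\<^sub>2)"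
  let ?M2 = "meet_irreducibles U\<^sub>2 (restriction \<C> U\<^sub>2)"
  have cs: "closure_system U \<C>"
    using assms(2) by (simp add: standard_closure_system_def)
  have part: "bipartition U U\<^sub>1 U\<^sub>2" and U2: "U\<^sub>2 \<in> \<C>"
    using assms(3) by (auto simp: acyclic_split_def)
  have disj: "U\<^sub>1 \<inter> U\<^sub>2 = {}" and cover: "U\<^sub>1 \<union> U\<^sub>2 = U"
    using part by (auto simp: bipartition_def)
  have sub1: "X \<subseteq> U\<^sub>1" if "X \<in> ?M1" for X
    using that contraction_iff[OF cs part] meet_irreduciblesD(1) by blast
  have sub: "C \<subseteq> U" if "C \<in> \<C>" for C
    using cs that by (auto simp: closure_system_def)
  have fin: "finite \<C>"
    using assms(1) cs by (auto simp: closure_system_def intro: finite_subset)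

  have "M \<in> {M\<^sub>1 \<union> U\<^sub>2 | M\<^sub>1. M\<^sub>1 \<in> ?M1} \<union> {C | C M\<^sub>2. M\<^sub>2 \<in> ?M2 \<and> C \<in> max_sets (Ext \<C> U\<^sub>2 M\<^sub>2)}"
    if M: "M \<in> ?M" for M
  \<comment> \<open>Containing \<open>U\<^sub>2\<close> decides which of the two families
    \<open>M\<close> belongs to.\<close>
  proof (cases "U\<^sub>2 \<subseteq> M")
    case True
    then have eq: "M = (M \<inter> U\<^sub>1) \<union> U\<^sub>2"
      using sub[OF meet_irreduciblesD(1)[OF M]] cover by blast
    then have "M \<inter> U\<^sub>1 \<in> ?M1"
      using M meet_irreducibles_contraction_iff[OF cs part, of "M \<inter> U\<^sub>1"] by simp
    then show ?thesis using eq by blast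
  next
    case False
    then show ?thesis using meet_irreducible_trace[OF cs assms(3) M] by blast
  qed
  moreover have above: "X \<union> U\<^sub>2 \<in> ?M" if "X \<in> ?M1" for X
    using meet_irreducibles_contraction_iff[OF cs part sub1[OF that]] that by simp
  ultimately have eq: "?M = {M\<^sub>1 \<union> U\<^sub>2 | M\<^sub>1. M\<^sub>1 \<in> ?M1} \<union>
      {C | C M\<^sub>2. M\<^sub>2 \<in> ?M2 \<and> C \<in> max_sets (Ext \<C> U\<^sub>2 M\<^sub>2)}"
    using max_Ext_meet_irreducible(1)[OF cs U2] by blast

  have "max_sets (Ext \<C> U\<^sub>2 N) \<noteq> {}" if N: "N \<in> ?M2" for N
  proof (rule max_sets_nonempty)
    show "finite (Ext \<C> U\<^sub>2 N)" using fin by (simp add: Ext_def)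
    \<comment> \<open>A closed subset of \<open>U\<^sub>2\<close> is its own trace, hence its own
      smallest extension.\<close>
    have "N \<in> Ext \<C> U\<^sub>2 N"
      using meet_irreduciblesD(1)[OF N] by (auto simp: restriction_def Ext_def)
    then show "Ext \<C> U\<^sub>2 N \<noteq> {}" by blast
  qed
  then have "\<forall>N\<in>?M2. \<exists>C. C \<in> max_sets (Ext \<C> U\<^sub>2 N)" by blast
  \<comment> \<open>The function \<open>g\<close> selects one maximal extension of each irreducible
    \<open>N\<close>; there may be several, which is why the count is only a lower bound.\<close>
  then obtain g where g: "\<And>N. N \<in> ?M2 \<Longrightarrow> g N \<in> max_sets (Ext \<C> U\<^sub>2 N)"
    by metis
  have g_irr: "g N \<in> ?M" "\<not> U\<^sub>2 \<subseteq> g N" if "N \<in> ?M2" for N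
    using max_Ext_meet_irreducible[OF cs U2 that g[OF that]] by auto
  have inj1: "inj_on (\<lambda>X. X \<union> U\<^sub>2) ?M1"
  proof (rule inj_onI)
    fix X Y assume "X \<in> ?M1" "Y \<in> ?M1" "X \<union> U\<^sub>2 = Y \<union> U\<^sub>2"
    then show "X = Y" using sub1[of X] sub1[of Y] disj by blast
  qed
  \<comment> \<open>The trace on \<open>U\<^sub>2\<close> is a left inverse of \<open>g\<close>,
    which gives injectivity.\<close>
  have "g N \<inter> U\<^sub>2 = N" if "N \<in> ?M2" for N
    using g[OF that] by (simp add: max_sets_def Ext_def)
  then have inj2: "inj_on g ?M2" by (rule inj_on_inverseI)
  have finM: "finite ?M" using fin by (simp add: meet_irreducibles_def)
  have img: "(\<lambda>X. X \<union> U\<^sub>2) ` ?M1 \<subseteq> ?M" "g ` ?M2 \<subseteq> ?M"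
    using above g_irr(1) by blast+
  have "card ?M1 + card ?M2 = card ((\<lambda>X. X \<union> U\<^sub>2) ` ?M1) + card (g ` ?M2)"
    using inj1 inj2 by (simp add: card_image)
  \<comment> \<open>The images are disjoint: every member of the first contains
    \<open>U\<^sub>2\<close>, and no member of the second does.\<close>
  also have "\<dots> = card ((\<lambda>X. X \<union> U\<^sub>2) ` ?M1 \<union> g ` ?M2)"
    using img finM g_irr(2) by (intro card_Un_disjoint[symmetric]) (auto intro: finite_subset)
  also have "\<dots> \<le> card ?M" using img finM by (intro card_mono) auto
  finally show ?thesis using eq by blast
qed

end
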